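(* Let $g,h$ be arithmetic functions with $g(1)=1$ and $0<h(n)\le h(n+1)$ for all $n\ge 1$, put $h(0):=0$, and let $P_n^{g,h}(x)$ be the associated polynomials. Let $0<\varepsilon<1$. Assume that the power series $$G_1(T)=\sum_{k=1}^{\infty}|g(k+1)|\,T^k$$ has radius of convergence $R>0$ (possibly $R=\infty$). Let $0<T_\varepsilon<R$ be such that $G_1(T_\varepsilon)\le\varepsilon$, and put $\kappa=\kappa_\varepsilon=\frac{1}{1-\varepsilon}\frac{1}{T_\varepsilon}$. Then for all $n\ge 1$ and all $x\in\mathbb{C}$ with $|x|>\kappa\,h(n-1)$, $$(1-\varepsilon)\frac{|x|}{h(n)}\left|P_{n-1}^{g,h}(x)\right|<\left|P_n^{g,h}(x)\right|<(1+\varepsilon)\frac{|x|}{h(n)}\left|P_{n-1}^{g,h}(x)\right|.$$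
   Context: An arithmetic function is a function on the positive integers; $g$ is complex-valued and $h$ is real-valued. The polynomials $P_n^{g,h}(x)$ are defined by $P_0^{g,h}(x)=1$ and, for $n\ge1$, $$P_n^{g,h}(x)=\frac{x}{h(n)}\sum_{k=1}^{n}g(k)\,P_{n-k}^{g,h}(x).$$ *)

theory Defs
  imports "HOL-Analysis.Analysis" "HOL-Computational_Algebra.Polynomial"
begin

(* Arithmetic functions are represented as functions on nat; the values g 0 and h 0
   never enter the recursion. *)
fun P_poly :: "(nat \<Rightarrow> complex) \<Rightarrow> (nat \<Rightarrow> real) \<Rightarrow> nat \<Rightarrow> complex poly" where
  "P_poly g h 0 = 1"
| "P_poly g h (Suc n) =
     smult (1 / complex_of_real (h (Suc n)))
       ([:0, 1:] * (\<Sum>k = 1..Suc n. smult (g k) (P_poly g h (Suc n - k))))"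

definition G1 :: "(nat \<Rightarrow> complex) \<Rightarrow> real fps" where
  "G1 g = Abs_fps (\<lambda>k. if k = 0 then 0 else cmod (g (k + 1)))"

lemma poly_P_poly_0: "poly (P_poly g h 0) x = 1"
  by simp

lemma poly_P_poly_rec:
  assumes "n \<ge> 1"
  shows "poly (P_poly g h n) x =
    x / complex_of_real (h n) * (\<Sum>k = 1..n. g k * poly (P_poly g h (n - k)) x)"
proof -
  obtain m where n: "n = Suc m"
    using assms by (cases n) auto
  show ?thesis
    unfolding n P_poly.simps by (simp only: poly_smult poly_mult poly_sum) simp
qed

end

(* The term k = 1 of the recursion is (x / h n) P_{n-1}, so it suffices that the remaining terms
   have total modulus below \<epsilon> (|x| / h n) |P_{n-1}|. By induction the lower bounds hold at all smaller
   indices, which makes the moduli grow geometrically: |P_{j-1}| \<le> q |P_j| for j < n, with the ratio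
   q = h (n-1) / ((1 - \<epsilon>) |x|) < T\<^sub>\<epsilon>. Hence the remaining terms are controlled by
   G_1(q) \<le> (q / T\<^sub>\<epsilon>) G_1(T\<^sub>\<epsilon>) < \<epsilon>. *)
theory Submission
  imports Defs
begin

text \<open>Since \<open>g 1 = 1\<close>, the term k = 1 contributes the previous polynomial with
  coefficient 1. Shifting the remaining indices turns their weights into \<open>g (Suc k)\<close>,
  the coefficients whose moduli form \<open>G1 g\<close>.\<close>

lemma poly_P_poly_Suc:
  assumes "g 1 = 1"
  shows "poly (P_poly g h (Suc m)) x =
    x / complex_of_real (h (Suc m)) *
      (poly (P_poly g h m) x + (\<Sum>k = 1..m. g (Suc k) * poly (P_poly g h (m - k)) x))"
proof -
  have "(\<Sum>k = 1..Suc m. g k * poly (P_poly g h (Suc m - k)) x)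
      = poly (P_poly g h m) x + (\<Sum>k = Suc 1..Suc m. g k * poly (P_poly g h (Suc m - k)) x)"
    using assms by (subst sum.atLeast_Suc_atMost) auto
  also have "(\<Sum>k = Suc 1..Suc m. g k * poly (P_poly g h (Suc m - k)) x)
      = (\<Sum>k = 1..m. g (Suc k) * poly (P_poly g h (m - k)) x)"
    by (subst sum.shift_bounds_cl_Suc_ivl) simp
  finally show ?thesis
    by (simp only: poly_P_poly_rec[of "Suc m"])
qed

text \<open>All terms are nonnegative and the series converges at \<open>T\<close>, so its value
  dominates every finite partial sum; the constant coefficient of \<open>G1 g\<close> is 0, so
  starting at k = 1 loses nothing.\<close>

lemma G1_partial_sum_le_eval:
  assumes "0 \<le> T" and "ereal T < fps_conv_radius (G1 g)"
  shows "(\<Sum>k = 1..m. cmod (g (Suc k)) * T ^ k) \<le> eval_fps (G1 g) T"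
proof -
  have "(\<Sum>k = 1..m. cmod (g (Suc k)) * T ^ k) = (\<Sum>k = 1..m. fps_nth (G1 g) k * T ^ k)"
    by (intro sum.cong) (auto simp: G1_def)
  also have "\<dots> \<le> (\<Sum>k. fps_nth (G1 g) k * T ^ k)"
  proof (rule sum_le_suminf)
    show "summable (\<lambda>k. fps_nth (G1 g) k * T ^ k)"
      using assms by (intro summable_fps) simp
  qed (use assms in \<open>auto simp: G1_def\<close>)
  finally show ?thesis
    by (simp add: eval_fps_def)
qed

lemma geometric_decrease:
  fixes p :: "nat \<Rightarrow> real"
  assumes "0 \<le> q" and step: "\<And>j. j < m \<Longrightarrow> p j \<le> q * p (Suc j)"
    and "k \<le> m"
  shows "p (m - k) \<le> q ^ k * p m"
  using \<open>k \<le> m\<close>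
proof (induction k)
  case (Suc k)
  have "p (m - Suc k) \<le> q * p (m - k)"
    using step[of "m - Suc k"] Suc.prems by (simp add: Suc_diff_Suc)
  also have "\<dots> \<le> q * (q ^ k * p m)"
    using Suc \<open>0 \<le> q\<close> by (intro mult_left_mono) auto
  finally show ?case
    by (simp add: mult.assoc)
qed simp

text \<open>Iterating \<open>step\<close> bounds \<open>norm (b (m - k))\<close> by
  \<open>q ^ k * norm (b m)\<close>. As k is at least 1, one factor \<open>q\<close> can be kept
  while the others are enlarged to \<open>T\<close>, so a common factor \<open>q / T\<close> comes
  out of the sum.\<close>

lemma norm_weighted_sum_less:
  fixes a b :: "nat \<Rightarrow> 'a :: real_normed_div_algebra"
  assumes "0 \<le> q" and "q < T" and "0 < \<epsilon>"
    and S: "(\<Sum>k = 1..m. norm (a k) * T ^ k) \<le> \<epsilon>"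
    and step: "\<And>j. j < m \<Longrightarrow> norm (b j) \<le> q * norm (b (Suc j))"
    and "b m \<noteq> 0"
  shows "norm (\<Sum>k = 1..m. a k * b (m - k)) < \<epsilon> * norm (b m)"
proof -
  have T: "0 < T" using assms by simp
  have term_le: "norm (a k * b (m - k)) \<le> q / T * (norm (a k) * T ^ k) * norm (b m)"
    if k: "k \<in> {1..m}" for k
  proof -
    obtain i where i: "k = Suc i" using k by (cases k) auto
    have "q ^ k \<le> q * T ^ i"
      unfolding i using assms by (auto intro!: mult_left_mono power_mono)
    also have "\<dots> = q / T * T ^ k"
      using T by (simp add: i)
    finally have "q ^ k \<le> q / T * T ^ k" .
    moreover have "norm (b (m - k)) \<le> q ^ k * norm (b m)"
      using geometric_decrease[of q m "\<lambda>j. norm (b j)" k] assms k by simp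
    ultimately have "norm (b (m - k)) \<le> q / T * T ^ k * norm (b m)"
      by (meson mult_right_mono norm_ge_zero order_trans)
    then have "norm (a k) * norm (b (m - k)) \<le> norm (a k) * (q / T * T ^ k * norm (b m))"
      by (intro mult_left_mono) auto
    then show ?thesis
      by (simp add: norm_mult mult_ac)
  qed
  have "norm (\<Sum>k = 1..m. a k * b (m - k))
      \<le> (\<Sum>k = 1..m. q / T * (norm (a k) * T ^ k) * norm (b m))"
    by (rule sum_norm_le) (rule term_le)
  also have "\<dots> = q / T * (\<Sum>k = 1..m. norm (a k) * T ^ k) * norm (b m)"
    by (simp only: sum_distrib_left sum_distrib_right)
  also have "\<dots> \<le> q / T * \<epsilon> * norm (b m)"
    using S T \<open>0 \<le> q\<close> by (intro mult_right_mono mult_left_mono) auto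
  \<comment> \<open>Strictness comes from \<open>q / T < 1\<close>; it needs both \<epsilon> and
    \<open>norm (b m)\<close> to be positive.\<close>
  also have "\<dots> < 1 * \<epsilon> * norm (b m)"
    using assms T by (intro mult_strict_right_mono) auto
  finally show ?thesis by simp
qed

theorem theorem2:
  fixes g :: "nat \<Rightarrow> complex" and h :: "nat \<Rightarrow> real"
    and \<epsilon> T\<^sub>\<epsilon> \<kappa> :: real and R :: ereal
  assumes "g 1 = 1"
    and "\<And>n. n \<ge> 1 \<Longrightarrow> 0 < h n \<and> h n \<le> h (n + 1)"
    and "h 0 = 0"
    and "0 < \<epsilon>" and "\<epsilon> < 1"
    and "R = fps_conv_radius (G1 g)" and "R > 0"
    and "0 < T\<^sub>\<epsilon>" and "ereal T\<^sub>\<epsilon> < R"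
    and "eval_fps (G1 g) T\<^sub>\<epsilon> \<le> \<epsilon>"
    and "\<kappa> = 1 / (1 - \<epsilon>) * (1 / T\<^sub>\<epsilon>)"
  shows "\<forall>n\<ge>1. \<forall>x::complex. cmod x > \<kappa> * h (n - 1) \<longrightarrow>
    (1 - \<epsilon>) * (cmod x / h n) * cmod (poly (P_poly g h (n - 1)) x)
      < cmod (poly (P_poly g h n) x) \<and>
    cmod (poly (P_poly g h n) x)
      < (1 + \<epsilon>) * (cmod x / h n) * cmod (poly (P_poly g h (n - 1)) x)"
proof (intro allI impI)
  fix n :: nat and x :: complex
  assume "n \<ge> 1" and "cmod x > \<kappa> * h (n - 1)"
  let ?P = "\<lambda>n. poly (P_poly g h n) x"
  have hpos: "0 < h (Suc m)" for m
    using assms(2)[of "Suc m"] by simp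
  have hmono: "h i \<le> h j" if "i \<le> j" for i j
  proof (rule lift_Suc_mono_le[OF _ that])
    \<comment> \<open>Monotonicity extends down to index 0 because \<open>h 0 = 0\<close> lies below
      \<open>h 1 > 0\<close>.\<close>
    fix m show "h m \<le> h (Suc m)"
      using assms(2)[of m] assms(3) hpos[of m] by (cases m) auto
  qed
  have h0: "0 \<le> h m" for m
    using hmono[of 0 m] assms(3) by simp
  have \<kappa>: "0 < \<kappa>"
    using assms by simp
  \<comment> \<open>The claim is shifted to n = \<open>Suc m\<close>. Nonvanishing of
    \<open>?P m\<close> is carried along because the strict bound on the remaining terms depends on
    it.\<close>
  have main: "?P m \<noteq> 0 \<and>
      (1 - \<epsilon>) * (cmod x / h (Suc m)) * cmod (?P m) < cmod (?P (Suc m)) \<and>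
      cmod (?P (Suc m)) < (1 + \<epsilon>) * (cmod x / h (Suc m)) * cmod (?P m)"
    if "cmod x > \<kappa> * h m" for m
    using that
  proof (induction m rule: less_induct)
    case (less m)
    have x: "0 < cmod x"
      using less.prems \<kappa> h0[of m] by (smt (verit) mult_nonneg_nonneg)
    define q where "q = h m / ((1 - \<epsilon>) * cmod x)"
    have q0: "0 \<le> q"
      using h0[of m] x assms(5) by (simp add: q_def)
    \<comment> \<open>This is the assumption \<open>cmod x > \<kappa> * h m\<close> rearranged,
      which explains the choice of \<kappa>.\<close>
    have qT: "q < T\<^sub>\<epsilon>"
      using less.prems x assms(5,8) by (simp add: q_def assms(11) field_simps)
    have IH: "?P j \<noteq> 0 \<and> (1 - \<epsilon>) * (cmod x / h (Suc j)) * cmod (?P j) < cmod (?P (Suc j))"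
      if "j < m" for j
    proof -
      \<comment> \<open>The condition on \<open>x\<close> passes to smaller indices because
        \<open>h\<close> is monotone.\<close>
      have "\<kappa> * h j \<le> \<kappa> * h m"
        using hmono[of j m] that \<kappa> by simp
      then show ?thesis
        using less.IH[OF that] less.prems by simp
    qed
    have step: "cmod (?P j) \<le> q * cmod (?P (Suc j))" if "j < m" for j
    proof -
      have "cmod (?P j) \<le> h (Suc j) / ((1 - \<epsilon>) * cmod x) * cmod (?P (Suc j))"
        using IH[OF that] x assms(5) hpos[of j] by (simp add: field_simps)
      \<comment> \<open>Since \<open>Suc j\<close> is at most \<open>m\<close>, the ratio depending
        on \<open>j\<close> is at most \<open>q\<close>, which serves all \<open>j < m\<close> at
        once.\<close>
      also have "\<dots> \<le> q * cmod (?P (Suc j))"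
        unfolding q_def using hmono[of "Suc j" m] that x assms(5)
        by (intro mult_right_mono divide_right_mono) auto
      finally show ?thesis .
    qed
    \<comment> \<open>For \<open>m = 0\<close> the value is 1; otherwise the lower bound at the
      preceding index puts the modulus strictly above a nonnegative number.\<close>
    have nz: "?P m \<noteq> 0"
    proof (cases m)
      case (Suc j)
      have "0 \<le> (1 - \<epsilon>) * (cmod x / h (Suc j)) * cmod (?P j)"
        using assms(5) hpos[of j] by simp
      then show ?thesis
        using IH[of j] Suc by auto
    qed simp
    define r where "r = (\<Sum>k = 1..m. g (Suc k) * ?P (m - k))"
    have "(\<Sum>k = 1..m. cmod (g (Suc k)) * T\<^sub>\<epsilon> ^ k) \<le> \<epsilon>"
      using G1_partial_sum_le_eval[of T\<^sub>\<epsilon> g m] assms(6,8,9,10) by simp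
    then have r: "cmod r < \<epsilon> * cmod (?P m)"
      unfolding r_def
      using q0 qT assms(4) step nz by (intro norm_weighted_sum_less[where q = q and T = T\<^sub>\<epsilon>])
    have P: "cmod (?P (Suc m)) = cmod x / h (Suc m) * cmod (?P m + r)"
      unfolding poly_P_poly_Suc[of g, OF assms(1)] r_def
      using hpos[of m] by (simp add: norm_mult norm_divide)
    have c: "0 < cmod x / h (Suc m)"
      using x hpos[of m] by simp
    have lower: "(1 - \<epsilon>) * cmod (?P m) < cmod (?P m + r)"
      using norm_triangle_ineq2[of "?P m" "- r"] r by (simp add: algebra_simps)
    have upper: "cmod (?P m + r) < (1 + \<epsilon>) * cmod (?P m)"
      using norm_triangle_ineq[of "?P m" r] r by (simp add: algebra_simps)
    show ?case
      using nz mult_strict_left_mono[OF lower c] mult_strict_left_mono[OF upper c]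
      unfolding P by (simp only: mult_ac) simp
  qed
  show "(1 - \<epsilon>) * (cmod x / h n) * cmod (?P (n - 1)) < cmod (?P n) \<and>
      cmod (?P n) < (1 + \<epsilon>) * (cmod x / h n) * cmod (?P (n - 1))"
    using main[of "n - 1"] \<open>n \<ge> 1\<close> \<open>cmod x > \<kappa> * h (n - 1)\<close> by simp
qed

end
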